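(* Let $E$ be an evolution algebra of finite dimension $n$ over a field $\mathbb{K}$ whose structural matrix $A$ has rank $n$ (nonsingular). Then any two natural bases $\mathcal{B}$ and $\mathcal{B}'$ of $E$ give rise to isomorphic underlying graphs: $\Gamma(E,\mathcal{B})\cong\Gamma(E,\mathcal{B}')$.
   Context: An evolution algebra over $\mathbb{K}$ (finite-dimensional) is an algebra $E$ with a linear basis $\mathcal{B}=\{e_1,\dots,e_n\}$ (a natural basis) such that $e_ie_j=0$ for $i\neq j$ and $e_i^2=\sum_k a_{ik}e_k$ with $a_{ik}\in\mathbb{K}$; $A=(a_{ik})$ is the structural matrix with respect to $\mathcal{B}$. The graph $\Gamma(E,\mathcal{B})$ is the simple graph with vertex set $\{1,\dots,n\}$ and edges $\{i,j\}$, $i\ne j$, whenever $a_{ij}\neq0$ or $a_{ji}\ne0$. *)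

theory Defs
  imports Complex_Main "Jordan_Normal_Form.DL_Rank"
begin

text \<open>The algebra is a whole type, with no associativity, commutativity or unit assumed.\<close>

locale nonassoc_algebra = vector_space scale
  for scale :: "'k::field \<Rightarrow> 'e::ab_group_add \<Rightarrow> 'e" +
  fixes mult :: "'e \<Rightarrow> 'e \<Rightarrow> 'e"
  assumes linear_mult_right: "Vector_Spaces.linear scale scale (\<lambda>y. mult x y)"
    and linear_mult_left: "Vector_Spaces.linear scale scale (\<lambda>x. mult x y)"
begin

text \<open>A basis is an indexed family \<open>e 0, \<dots>, e (n - 1)\<close>, numbered from 0 to agree with the
  indices of \<open>mat\<close>; the values of \<open>e\<close> outside \<open>{..<n}\<close> are irrelevant.\<close>

definition natural_basis :: "nat \<Rightarrow> (nat \<Rightarrow> 'e) \<Rightarrow> bool" where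
  "natural_basis n e \<longleftrightarrow>
     inj_on e {..<n} \<and> independent (e ` {..<n}) \<and> span (e ` {..<n}) = UNIV \<and>
     (\<forall>i<n. \<forall>j<n. i \<noteq> j \<longrightarrow> mult (e i) (e j) = 0)"

text \<open>Row \<open>i\<close> lists the coordinates of the square of \<open>e i\<close>.\<close>

definition structural_matrix :: "nat \<Rightarrow> (nat \<Rightarrow> 'e) \<Rightarrow> 'k mat" where
  "structural_matrix n e =
     mat n n (\<lambda>(i, k). representation (e ` {..<n}) (mult (e i) (e i)) (e k))"

end

locale evolution_algebra = nonassoc_algebra +
  assumes ex_natural_basis: "\<exists>n e. natural_basis n e"

text \<open>A simple graph is a vertex set together with a set of two-element sets of vertices.\<close>

type_synonym 'v simple_graph = "'v set \<times> 'v set set"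

definition graph_iso :: "'v simple_graph \<Rightarrow> 'w simple_graph \<Rightarrow> bool" where
  "graph_iso G H \<longleftrightarrow>
     (\<exists>f. bij_betw f (fst G) (fst H) \<and>
        (\<forall>u\<in>fst G. \<forall>v\<in>fst G. {u, v} \<in> snd G \<longleftrightarrow> {f u, f v} \<in> snd H))"

definition (in nonassoc_algebra) underlying_graph :: "nat \<Rightarrow> (nat \<Rightarrow> 'e) \<Rightarrow> nat simple_graph" where
  "underlying_graph n e =
     ({..<n},
      {{i, j} | i j. i < n \<and> j < n \<and> i \<noteq> j \<and>
         (structural_matrix n e $$ (i, j) \<noteq> 0 \<or> structural_matrix n e $$ (j, i) \<noteq> 0)})"

end

theory Submission imports Defs begin

text \<open>
  Write a second natural basis in terms of the first as \<open>e i = (\<Sum>k. p i k b k)\<close>. For \<open>i \<noteq> j\<close> the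
  product \<open>e i e j = (\<Sum>k. p i k p j k (b k)\<^sup>2)\<close> vanishes, and the squares \<open>(b k)\<^sup>2\<close> are linearly
  independent since the structural matrix is nonsingular, so \<open>p i k p j k = 0\<close>. Every column of
  the invertible matrix \<open>p\<close> thus has exactly one nonzero entry: \<open>p\<close> is monomial. Hence all
  natural bases agree up to permutation and nonzero scalars, and such a change of basis does
  not affect which entries of the structural matrix are zero, up to relabelling.
\<close>

context nonassoc_algebra
begin

lemma mult_sum_right: "mult x (sum f S) = (\<Sum>i\<in>S. mult x (f i))"
proof -
  interpret R: Vector_Spaces.linear scale scale "\<lambda>y. mult x y"
    by (rule linear_mult_right)
  show ?thesis by (rule R.sum)
qed

lemma mult_sum_left: "mult (sum f S) x = (\<Sum>i\<in>S. mult (f i) x)"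
proof -
  interpret L: Vector_Spaces.linear scale scale "\<lambda>y. mult y x"
    by (rule linear_mult_left)
  show ?thesis by (rule L.sum)
qed

lemma mult_scale_right: "mult x (scale c y) = scale c (mult x y)"
proof -
  interpret R: Vector_Spaces.linear scale scale "\<lambda>y. mult x y"
    by (rule linear_mult_right)
  show ?thesis by (rule R.scale)
qed

lemma mult_scale_left: "mult (scale c y) x = scale c (mult y x)"
proof -
  interpret L: Vector_Spaces.linear scale scale "\<lambda>y. mult y x"
    by (rule linear_mult_left)
  show ?thesis by (rule L.scale)
qed

text \<open>Coordinates are indexed by position rather than by basis vector, so that sums run over
  \<open>{..<n}\<close> as matrix sums do.\<close>

definition coord :: "nat \<Rightarrow> (nat \<Rightarrow> 'e) \<Rightarrow> 'e \<Rightarrow> nat \<Rightarrow> 'k" where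
  "coord n e x k = representation (e ` {..<n}) x (e k)"

lemma structural_matrix_nth:
  "i < n \<Longrightarrow> k < n \<Longrightarrow> structural_matrix n e $$ (i, k) = coord n e (mult (e i) (e i)) k"
  by (simp add: structural_matrix_def coord_def)

lemma structural_matrix_carrier: "structural_matrix n e \<in> carrier_mat n n"
  by (simp add: structural_matrix_def)

lemma sum_coord:
  assumes "natural_basis n e"
  shows "(\<Sum>k<n. scale (coord n e x k) (e k)) = x"
proof -
  have B: "inj_on e {..<n}" "independent (e ` {..<n})" "span (e ` {..<n}) = UNIV"
    using assms by (auto simp: natural_basis_def)
  have "(\<Sum>v\<in>e ` {..<n}. scale (representation (e ` {..<n}) x v) v) = x"
    by (rule sum_representation_eq) (use B in auto)
  then show ?thesis
    by (simp add: sum.reindex[OF B(1)] coord_def)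
qed

lemma coord_sum:
  assumes "natural_basis n e" "k < n"
  shows "coord n e (\<Sum>i\<in>S. scale (u i) (f i)) k = (\<Sum>i\<in>S. u i * coord n e (f i) k)"
proof -
  have B: "independent (e ` {..<n})" "span (e ` {..<n}) = UNIV"
    using assms by (auto simp: natural_basis_def)
  show ?thesis
    by (simp add: coord_def representation_sum representation_scale B)
qed

lemma coord_scale:
  assumes "natural_basis n e" "k < n"
  shows "coord n e (scale c x) k = c * coord n e x k"
  using coord_sum[OF assms, of "\<lambda>_. c" "\<lambda>_. x" "{0::nat}"] by simp

lemma coord_basis:
  assumes "natural_basis n e" "i < n" "k < n"
  shows "coord n e (e i) k = (if i = k then 1 else 0)"
proof -
  have B: "inj_on e {..<n}" "independent (e ` {..<n})"
    using assms by (auto simp: natural_basis_def)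
  show ?thesis
    using assms(2,3) B by (auto simp: coord_def representation_basis inj_on_def)
qed

lemma coord_sum_basis:
  assumes "natural_basis n e" "k < n"
  shows "coord n e (\<Sum>i<n. scale (u i) (e i)) k = u k"
proof -
  have "(\<Sum>i<n. u i * coord n e (e i) k) = (\<Sum>i<n. if i = k then u i else 0)"
    using assms by (intro sum.cong) (auto simp: coord_basis)
  then show ?thesis
    using assms by (simp add: coord_sum)
qed

text \<open>Bilinear expansion of both factors leaves only the diagonal terms, because distinct
  vectors of a natural basis multiply to zero.\<close>

lemma mult_coord:
  assumes "natural_basis n e"
  shows "mult x y = (\<Sum>i<n. scale (coord n e x i * coord n e y i) (mult (e i) (e i)))"
proof -
  have orth: "mult (e i) (e j) = 0" if "i < n" "j < n" "i \<noteq> j" for i j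
    using assms that by (simp add: natural_basis_def)
  have "mult x y = mult (\<Sum>i<n. scale (coord n e x i) (e i)) (\<Sum>j<n. scale (coord n e y j) (e j))"
    by (simp add: sum_coord[OF assms])
  also have "\<dots> = (\<Sum>i<n. \<Sum>j<n. scale (coord n e x i * coord n e y j) (mult (e i) (e j)))"
    unfolding mult_sum_left
    by (simp add: mult_sum_right mult_scale_left mult_scale_right scale_sum_right mult.commute)
  also have "\<dots> = (\<Sum>i<n. \<Sum>j<n. if j = i
      then scale (coord n e x i * coord n e y i) (mult (e i) (e i)) else 0)"
    by (intro sum.cong) (auto simp: orth)
  finally show ?thesis
    by simp
qed

text \<open>Row \<open>i\<close> of the structural matrix holds the coordinates of the square of
  \<open>e i\<close>, so a linear relation among the squares is a kernel vector of the transpose.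
  Full rank makes the determinant of the transpose nonzero, and this kernel is trivial.\<close>

lemma squares_independent:
  assumes nb: "natural_basis n e"
    and rank: "vec_space.rank n (structural_matrix n e) = n"
    and zero: "(\<Sum>i<n. scale (u i) (mult (e i) (e i))) = 0"
    and "i < n"
  shows "u i = 0"
proof -
  let ?A = "structural_matrix n e"
  have A: "?A \<in> carrier_mat n n" by (rule structural_matrix_carrier)
  have "det ?A\<^sup>T \<noteq> 0"
    using vec_space.det_rank_iff[OF A] rank det_transpose[OF A] by simp
  moreover have "?A\<^sup>T *\<^sub>v vec n u = 0\<^sub>v n"
  proof (rule eq_vecI)
    fix k assume "k < dim_vec (0\<^sub>v n :: 'k vec)"
    then have k: "k < n" by simp
    have "(?A\<^sup>T *\<^sub>v vec n u) $ k = (\<Sum>i<n. u i * coord n e (mult (e i) (e i)) k)"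
      using A k by (auto simp: scalar_prod_def structural_matrix_nth lessThan_atLeast0
          mult.commute intro!: sum.cong)
    also have "\<dots> = coord n e 0 k"
      using coord_sum[OF nb k, of u "\<lambda>i. mult (e i) (e i)" "{..<n}"] zero by simp
    also have "\<dots> = 0"
      using coord_scale[OF nb k, of 0 0] by simp
    finally show "(?A\<^sup>T *\<^sub>v vec n u) $ k = 0\<^sub>v n $ k"
      using k by simp
  qed (use A in simp)
  ultimately have "vec n u = 0\<^sub>v n"
    using det_0_iff_vec_prod_zero_field[of "?A\<^sup>T" n] A
    by (metis transpose_carrier_mat vec_carrier)
  then show ?thesis
    using \<open>i < n\<close> by (metis index_vec index_zero_vec(1))
qed

lemma natural_basis_monomial:
  assumes b: "natural_basis n b"
    and rank: "vec_space.rank n (structural_matrix n b) = n"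
    and e: "natural_basis n e"
  obtains \<sigma> c where "bij_betw \<sigma> {..<n} {..<n}"
    and "\<And>k. k < n \<Longrightarrow> c k \<noteq> 0 \<and> e (\<sigma> k) = scale (c k) (b k)"
proof -
  define p where "p i = coord n b (e i)" for i
  have orth: "p i k = 0 \<or> p j k = 0" if "i < n" "j < n" "i \<noteq> j" "k < n" for i j k
  proof -
    have "mult (e i) (e j) = 0"
      using e that by (simp add: natural_basis_def)
    then have "(\<Sum>k<n. scale (p i k * p j k) (mult (b k) (b k))) = 0"
      using mult_coord[OF b, of "e i" "e j"] by (simp add: p_def)
    from squares_independent[OF b rank this \<open>k < n\<close>] show ?thesis by simp
  qed
  \<comment> \<open>If column \<open>k\<close> of \<open>p\<close> were zero, every combination of
    the \<open>e i\<close> would have \<open>k\<close>-th coordinate 0 with respect to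
    \<open>b\<close>; but \<open>b k\<close> is such a combination and has coordinate 1.\<close>
  have "\<exists>i<n. p i k \<noteq> 0" if "k < n" for k
  proof (rule ccontr)
    assume "\<not> (\<exists>i<n. p i k \<noteq> 0)"
    then have "coord n b (\<Sum>i<n. scale (coord n e (b k) i) (e i)) k = 0"
      by (simp add: coord_sum[OF b that] p_def)
    then show False
      using coord_basis[OF b that that] by (simp add: sum_coord[OF e])
  qed
  then obtain \<sigma> where \<sigma>: "\<And>k. k < n \<Longrightarrow> \<sigma> k < n \<and> p (\<sigma> k) k \<noteq> 0"
    by metis
  \<comment> \<open>By \<open>orth\<close>, \<open>\<sigma> k\<close> is the only row with a nonzero
    entry in column \<open>k\<close>.\<close>
  have \<sigma>_eq: "\<sigma> k = i" if "i < n" "k < n" "p i k \<noteq> 0" for i k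
    using orth \<sigma> that by blast
  \<comment> \<open>No row of \<open>p\<close> vanishes, since \<open>e i\<close> is nonzero; a
    nonzero entry of row \<open>i\<close> in column \<open>k\<close> forces
    \<open>\<sigma> k = i\<close>. So \<open>\<sigma>\<close> is onto, hence injective because the
    index set is finite.\<close>
  have "{..<n} \<subseteq> \<sigma> ` {..<n}"
  proof
    fix i assume "i \<in> {..<n}"
    then have i: "i < n" by simp
    have "\<exists>k<n. p i k \<noteq> 0"
    proof (rule ccontr)
      assume "\<not> (\<exists>k<n. p i k \<noteq> 0)"
      then have "e i = 0"
        using sum_coord[OF b, of "e i"] by (simp add: p_def)
      then show False
        using e i dependent_zero[of "e ` {..<n}"] by (force simp: natural_basis_def)
    qed
    then show "i \<in> \<sigma> ` {..<n}"
      using \<sigma>_eq i by blast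
  qed
  moreover have "\<sigma> ` {..<n} \<subseteq> {..<n}"
    using \<sigma> by auto
  ultimately have bij: "bij_betw \<sigma> {..<n} {..<n}"
    by (simp add: bij_betw_def eq_card_imp_inj_on)
  have "e (\<sigma> k) = scale (p (\<sigma> k) k) (b k)" if "k < n" for k
  proof -
    \<comment> \<open>A nonzero entry here would give \<open>\<sigma> l = \<sigma> k\<close>,
      against injectivity.\<close>
    have "p (\<sigma> k) l = 0" if "l < n" "l \<noteq> k" for l
      using \<sigma>_eq[of "\<sigma> k" l] \<sigma> bij that \<open>k < n\<close> by (auto simp: bij_betw_def inj_on_def)
    then have "(\<Sum>l<n. scale (p (\<sigma> k) l) (b l)) = (\<Sum>l<n. if l = k then scale (p (\<sigma> k) k) (b k) else 0)"
      by (intro sum.cong) auto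
    then show ?thesis
      using sum_coord[OF b, of "e (\<sigma> k)"] that by (simp add: p_def)
  qed
  then show thesis
    using that[OF bij, of "\<lambda>k. p (\<sigma> k) k"] \<sigma> by blast
qed

text \<open>With A and A' the matrices for \<open>e\<close> and \<open>e'\<close>, computing the
  \<open>j\<close>-th coordinate in \<open>e\<close> of the square of \<open>e' (\<pi> i)\<close> in
  two ways gives \<open>g i * g i\<close> * A(i, j) = \<open>g j\<close> *
  A'(\<open>\<pi> i\<close>, \<open>\<pi> j\<close>), and all factors \<open>g\<close> are
  nonzero.\<close>

lemma structural_matrix_monomial:
  assumes e: "natural_basis n e" and e': "natural_basis n e'"
    and bij: "bij_betw \<pi> {..<n} {..<n}"
    and g: "\<And>i. i < n \<Longrightarrow> g i \<noteq> 0 \<and> e' (\<pi> i) = scale (g i) (e i)"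
    and "i < n" "j < n"
  shows "structural_matrix n e' $$ (\<pi> i, \<pi> j) = 0 \<longleftrightarrow> structural_matrix n e $$ (i, j) = 0"
proof -
  have \<pi>: "\<pi> k < n" if "k < n" for k
    using bij that by (auto simp: bij_betw_def)
  let ?s = "mult (e' (\<pi> i)) (e' (\<pi> i))"
  have "?s = scale (g i * g i) (mult (e i) (e i))"
    using g \<open>i < n\<close> by (simp add: mult_scale_left mult_scale_right)
  then have "coord n e ?s j = g i * g i * coord n e (mult (e i) (e i)) j"
    using coord_scale[OF e \<open>j < n\<close>] by simp
  moreover have "coord n e ?s j = g j * coord n e' ?s (\<pi> j)"
  proof -
    \<comment> \<open>The expansion in \<open>e'\<close>, reindexed along \<open>\<pi>\<close>,
      becomes an expansion in \<open>e\<close> whose coefficients can be read off.\<close>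
    have "?s = (\<Sum>k<n. scale (coord n e' ?s k) (e' k))"
      by (simp add: sum_coord[OF e'])
    also have "\<dots> = (\<Sum>k<n. scale (coord n e' ?s (\<pi> k)) (e' (\<pi> k)))"
      by (rule sum.reindex_bij_betw[OF bij, symmetric])
    also have "\<dots> = (\<Sum>k<n. scale (coord n e' ?s (\<pi> k) * g k) (e k))"
      using g by (intro sum.cong) auto
    finally have s: "?s = \<dots>" .
    show ?thesis
      using arg_cong[OF s, of "\<lambda>x. coord n e x j"] coord_sum_basis[OF e \<open>j < n\<close>]
      by (simp add: mult.commute)
  qed
  ultimately show ?thesis
    using g \<pi> \<open>i < n\<close> \<open>j < n\<close> by (auto simp: structural_matrix_nth)
qed

lemma underlying_graph_edge:
  assumes "i < n" "j < n"
  shows "{i, j} \<in> snd (underlying_graph n e) \<longleftrightarrow>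
    i \<noteq> j \<and> (structural_matrix n e $$ (i, j) \<noteq> 0 \<or> structural_matrix n e $$ (j, i) \<noteq> 0)"
  using assms by (auto simp: underlying_graph_def doubleton_eq_iff)

text \<open>Edges depend only on which matrix entries vanish, and \<open>\<pi>\<close> preserves
  this pattern for both orders of the indices.\<close>

lemma underlying_graph_monomial:
  assumes "natural_basis n e" "natural_basis n e'"
    and bij: "bij_betw \<pi> {..<n} {..<n}"
    and "\<And>i. i < n \<Longrightarrow> g i \<noteq> 0 \<and> e' (\<pi> i) = scale (g i) (e i)"
  shows "graph_iso (underlying_graph n e) (underlying_graph n e')"
proof -
  have V: "fst (underlying_graph n f) = {..<n}" for f
    by (simp add: underlying_graph_def)
  have \<pi>: "\<pi> i < n" if "i < n" for i
    using bij that by (auto simp: bij_betw_def)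
  have inj: "\<pi> i = \<pi> j \<longleftrightarrow> i = j" if "i < n" "j < n" for i j
    using bij that by (auto simp: bij_betw_def inj_on_def)
  show ?thesis
    unfolding graph_iso_def V
    using bij \<pi> inj structural_matrix_monomial[OF assms]
    by (intro exI[of _ \<pi>]) (simp add: underlying_graph_edge)
qed

text \<open>The rank is given for \<open>b\<close>, so \<open>e\<close> and \<open>e'\<close> are
  each compared with \<open>b\<close>, and the two monomial changes of basis are then
  composed.\<close>

lemma underlying_graph_unique:
  assumes b: "natural_basis n b"
    and rank: "vec_space.rank n (structural_matrix n b) = n"
    and e: "natural_basis n e" and e': "natural_basis n e'"
  shows "graph_iso (underlying_graph n e) (underlying_graph n e')"
proof -
  obtain \<sigma> c where \<sigma>: "bij_betw \<sigma> {..<n} {..<n}"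
    and c: "\<And>k. k < n \<Longrightarrow> c k \<noteq> 0 \<and> e (\<sigma> k) = scale (c k) (b k)"
    using natural_basis_monomial[OF b rank e] by blast
  obtain \<tau> d where \<tau>: "bij_betw \<tau> {..<n} {..<n}"
    and d: "\<And>k. k < n \<Longrightarrow> d k \<noteq> 0 \<and> e' (\<tau> k) = scale (d k) (b k)"
    using natural_basis_monomial[OF b rank e'] by blast
  define \<rho> where "\<rho> = inv_into {..<n} \<sigma>"
  have \<rho>: "bij_betw \<rho> {..<n} {..<n}"
    unfolding \<rho>_def by (rule bij_betw_inv_into[OF \<sigma>])
  have \<rho>_lt: "\<rho> i < n" if "i < n" for i
    using \<rho> that by (auto simp: bij_betw_def)
  have \<sigma>\<rho>: "\<sigma> (\<rho> i) = i" if "i < n" for i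
    using bij_betw_inv_into_right[OF \<sigma>] that by (simp add: \<rho>_def)
  show ?thesis
  proof (rule underlying_graph_monomial[OF e e' bij_betw_trans[OF \<rho> \<tau>]])
    fix i assume i: "i < n"
    \<comment> \<open>Both \<open>e i\<close> and its partner in \<open>e'\<close> are nonzero
      multiples of \<open>b (\<rho> i)\<close>, with factors \<open>c (\<rho> i)\<close> and
      \<open>d (\<rho> i)\<close>; hence the quotient.\<close>
    show "d (\<rho> i) / c (\<rho> i) \<noteq> 0 \<and> e' ((\<tau> \<circ> \<rho>) i) = scale (d (\<rho> i) / c (\<rho> i)) (e i)"
      using c[OF \<rho>_lt[OF i]] d[OF \<rho>_lt[OF i]] by (simp add: \<sigma>\<rho>[OF i])
  qed
qed

end

theorem theorem3p10:
  fixes scale :: "'k::field \<Rightarrow> 'e::ab_group_add \<Rightarrow> 'e"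
    and mult :: "'e \<Rightarrow> 'e \<Rightarrow> 'e"
    and n :: nat
    and b e e' :: "nat \<Rightarrow> 'e"
  assumes "evolution_algebra scale mult"
    and "nonassoc_algebra.natural_basis scale mult n b"
    and "vec_space.rank n (nonassoc_algebra.structural_matrix scale mult n b) = n"
    and "nonassoc_algebra.natural_basis scale mult n e"
    and "nonassoc_algebra.natural_basis scale mult n e'"
  shows "graph_iso (nonassoc_algebra.underlying_graph scale mult n e)
                   (nonassoc_algebra.underlying_graph scale mult n e')"
  using nonassoc_algebra.underlying_graph_unique[OF evolution_algebra.axioms(1)[OF assms(1)]
      assms(2-5)] .

end
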